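(* Let $R$ be an associative ring with identity and let $\alpha: R\to R$ be a ring endomorphism such that $R$ is $\alpha$-compatible. Then the following hold. (1) $R$ is symmetric if and only if $R$ is $\alpha$-symmetric. (2) $R$ is reversible if and only if $R$ is $\alpha$-reversible. (3) $R$ is semicommutative if and only if $R$ is $\alpha$-semicommutative.
   Context: Rings are associative with identity, not necessarily commutative; a ring endomorphism $\alpha$ is additive and multiplicative but is not assumed to satisfy $\alpha(1)=1$. The ring $R$ is $\alpha$-compatible if for all $a,b\in R$, $a\,\alpha(b)=0$ if and only if $ab=0$. The ring $R$ is symmetric if for all $a,b,c\in R$, $abc=0$ implies $acb=0$; reversible if for all $a,b\in R$, $ab=0$ implies $ba=0$; semicommutative if for all $a,b\in R$, $ab=0$ implies $aRb=0$ (that is, $arb=0$ for all $r\in R$). The ring $R$ is right $\alpha$-symmetric if for all $a,b,c\in R$, $abc=0$ implies $ac\,\alpha(b)=0$; left $\alpha$-symmetric if for all $a,b,c\in R$, $abc=0$ implies $\alpha(b)ac=0$; and $\alpha$-symmetric if it is both right and left $\alpha$-symmetric. The ring $R$ is right $\alpha$-reversible if for all $a,b\in R$, $ab=0$ implies $b\,\alpha(a)=0$; left $\alpha$-reversible if for all $a,b\in R$, $ab=0$ implies $\alpha(b)a=0$; and $\alpha$-reversible if it is both right and left $\alpha$-reversible. The ring $R$ is $\alpha$-semicommutative if for all $a,b\in R$, $ab=0$ implies $aR\alpha(b)=0$ (that is, $ar\,\alpha(b)=0$ for all $r\in R$). *)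

theory Defs
  imports "HOL-Algebra.Ring"
begin

text \<open>
  Noncommutative rings with identity are rendered by the locale \<open>ring\<close>, which does not exclude
  the zero ring. Endomorphisms need not preserve the identity, so \<open>ring_hom\<close> is too strong:
  only additivity and multiplicativity are required.
\<close>

definition ring_endo :: "('a, 'm) ring_scheme \<Rightarrow> ('a \<Rightarrow> 'a) set" where
  "ring_endo R = hom R R \<inter> hom (add_monoid R) (add_monoid R)"

definition compatible_ring :: "('a, 'm) ring_scheme \<Rightarrow> ('a \<Rightarrow> 'a) \<Rightarrow> bool" where
  "compatible_ring R \<alpha> \<longleftrightarrow>
    (\<forall>a\<in>carrier R. \<forall>b\<in>carrier R. a \<otimes>\<^bsub>R\<^esub> \<alpha> b = \<zero>\<^bsub>R\<^esub> \<longleftrightarrow> a \<otimes>\<^bsub>R\<^esub> b = \<zero>\<^bsub>R\<^esub>)"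

definition symmetric_ring :: "('a, 'm) ring_scheme \<Rightarrow> bool" where
  "symmetric_ring R \<longleftrightarrow>
    (\<forall>a\<in>carrier R. \<forall>b\<in>carrier R. \<forall>c\<in>carrier R.
      a \<otimes>\<^bsub>R\<^esub> b \<otimes>\<^bsub>R\<^esub> c = \<zero>\<^bsub>R\<^esub> \<longrightarrow> a \<otimes>\<^bsub>R\<^esub> c \<otimes>\<^bsub>R\<^esub> b = \<zero>\<^bsub>R\<^esub>)"

definition reversible_ring :: "('a, 'm) ring_scheme \<Rightarrow> bool" where
  "reversible_ring R \<longleftrightarrow>
    (\<forall>a\<in>carrier R. \<forall>b\<in>carrier R. a \<otimes>\<^bsub>R\<^esub> b = \<zero>\<^bsub>R\<^esub> \<longrightarrow> b \<otimes>\<^bsub>R\<^esub> a = \<zero>\<^bsub>R\<^esub>)"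

definition semicommutative_ring :: "('a, 'm) ring_scheme \<Rightarrow> bool" where
  "semicommutative_ring R \<longleftrightarrow>
    (\<forall>a\<in>carrier R. \<forall>b\<in>carrier R. a \<otimes>\<^bsub>R\<^esub> b = \<zero>\<^bsub>R\<^esub> \<longrightarrow>
      (\<forall>r\<in>carrier R. a \<otimes>\<^bsub>R\<^esub> r \<otimes>\<^bsub>R\<^esub> b = \<zero>\<^bsub>R\<^esub>))"

definition right_endo_symmetric_ring :: "('a, 'm) ring_scheme \<Rightarrow> ('a \<Rightarrow> 'a) \<Rightarrow> bool" where
  "right_endo_symmetric_ring R \<alpha> \<longleftrightarrow>
    (\<forall>a\<in>carrier R. \<forall>b\<in>carrier R. \<forall>c\<in>carrier R.
      a \<otimes>\<^bsub>R\<^esub> b \<otimes>\<^bsub>R\<^esub> c = \<zero>\<^bsub>R\<^esub> \<longrightarrow> a \<otimes>\<^bsub>R\<^esub> c \<otimes>\<^bsub>R\<^esub> \<alpha> b = \<zero>\<^bsub>R\<^esub>)"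

definition left_endo_symmetric_ring :: "('a, 'm) ring_scheme \<Rightarrow> ('a \<Rightarrow> 'a) \<Rightarrow> bool" where
  "left_endo_symmetric_ring R \<alpha> \<longleftrightarrow>
    (\<forall>a\<in>carrier R. \<forall>b\<in>carrier R. \<forall>c\<in>carrier R.
      a \<otimes>\<^bsub>R\<^esub> b \<otimes>\<^bsub>R\<^esub> c = \<zero>\<^bsub>R\<^esub> \<longrightarrow> \<alpha> b \<otimes>\<^bsub>R\<^esub> a \<otimes>\<^bsub>R\<^esub> c = \<zero>\<^bsub>R\<^esub>)"

definition endo_symmetric_ring :: "('a, 'm) ring_scheme \<Rightarrow> ('a \<Rightarrow> 'a) \<Rightarrow> bool" where
  "endo_symmetric_ring R \<alpha> \<longleftrightarrow> right_endo_symmetric_ring R \<alpha> \<and> left_endo_symmetric_ring R \<alpha>"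

definition right_endo_reversible_ring :: "('a, 'm) ring_scheme \<Rightarrow> ('a \<Rightarrow> 'a) \<Rightarrow> bool" where
  "right_endo_reversible_ring R \<alpha> \<longleftrightarrow>
    (\<forall>a\<in>carrier R. \<forall>b\<in>carrier R. a \<otimes>\<^bsub>R\<^esub> b = \<zero>\<^bsub>R\<^esub> \<longrightarrow> b \<otimes>\<^bsub>R\<^esub> \<alpha> a = \<zero>\<^bsub>R\<^esub>)"

definition left_endo_reversible_ring :: "('a, 'm) ring_scheme \<Rightarrow> ('a \<Rightarrow> 'a) \<Rightarrow> bool" where
  "left_endo_reversible_ring R \<alpha> \<longleftrightarrow>
    (\<forall>a\<in>carrier R. \<forall>b\<in>carrier R. a \<otimes>\<^bsub>R\<^esub> b = \<zero>\<^bsub>R\<^esub> \<longrightarrow> \<alpha> b \<otimes>\<^bsub>R\<^esub> a = \<zero>\<^bsub>R\<^esub>)"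

definition endo_reversible_ring :: "('a, 'm) ring_scheme \<Rightarrow> ('a \<Rightarrow> 'a) \<Rightarrow> bool" where
  "endo_reversible_ring R \<alpha> \<longleftrightarrow> right_endo_reversible_ring R \<alpha> \<and> left_endo_reversible_ring R \<alpha>"

definition endo_semicommutative_ring :: "('a, 'm) ring_scheme \<Rightarrow> ('a \<Rightarrow> 'a) \<Rightarrow> bool" where
  "endo_semicommutative_ring R \<alpha> \<longleftrightarrow>
    (\<forall>a\<in>carrier R. \<forall>b\<in>carrier R. a \<otimes>\<^bsub>R\<^esub> b = \<zero>\<^bsub>R\<^esub> \<longrightarrow>
      (\<forall>r\<in>carrier R. a \<otimes>\<^bsub>R\<^esub> r \<otimes>\<^bsub>R\<^esub> \<alpha> b = \<zero>\<^bsub>R\<^esub>))"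

end

theory Submission
  imports Defs
begin

text \<open>
  Compatibility says that a right-hand factor \<open>b\<close> may be exchanged with \<open>\<alpha> b\<close> in any
  vanishing product. In each right-sided twisted condition, and in twisted semicommutativity,
  \<open>\<alpha>\<close> acts on the last factor of the conclusion, so erasing it turns the twisted condition into
  the untwisted one: these equivalences are immediate (\<open>right_endo_symmetric_iff\<close>,
  \<open>right_endo_reversible_iff\<close>, \<open>endo_semicommutative_iff\<close>).

  In the left-sided conditions \<open>\<alpha> b\<close> is the first factor, where compatibility says nothing
  directly. They nevertheless follow from the untwisted conditions: apply \<open>\<alpha>\<close> while the factor
  stands last, then bring it to the front by reversibility. For a symmetric ring this is possible
  because the identity element makes it reversible (\<open>symmetric_imp_reversible\<close>).
\<close>

lemma ring_endo_closed:
  assumes "\<alpha> \<in> ring_endo R" "a \<in> carrier R"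
  shows "\<alpha> a \<in> carrier R"
  using assms by (auto simp: ring_endo_def hom_def)

lemma compatible_ringD:
  assumes "compatible_ring R \<alpha>" "a \<in> carrier R" "b \<in> carrier R"
  shows "a \<otimes>\<^bsub>R\<^esub> \<alpha> b = \<zero>\<^bsub>R\<^esub> \<longleftrightarrow> a \<otimes>\<^bsub>R\<^esub> b = \<zero>\<^bsub>R\<^esub>"
  using assms by (simp add: compatible_ring_def)

lemma right_endo_symmetric_iff:
  assumes "ring R" "compatible_ring R \<alpha>"
  shows "right_endo_symmetric_ring R \<alpha> \<longleftrightarrow> symmetric_ring R"
proof -
  interpret ring R by fact
  show ?thesis
    by (simp add: right_endo_symmetric_ring_def symmetric_ring_def compatible_ringD[OF assms(2)])
qed

lemma right_endo_reversible_iff: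
  assumes "compatible_ring R \<alpha>"
  shows "right_endo_reversible_ring R \<alpha> \<longleftrightarrow> reversible_ring R"
  by (simp add: right_endo_reversible_ring_def reversible_ring_def compatible_ringD[OF assms])

lemma endo_semicommutative_iff:
  assumes "ring R" "compatible_ring R \<alpha>"
  shows "endo_semicommutative_ring R \<alpha> \<longleftrightarrow> semicommutative_ring R"
proof -
  interpret ring R by fact
  show ?thesis
    by (simp add: endo_semicommutative_ring_def semicommutative_ring_def
        compatible_ringD[OF assms(2)])
qed

text \<open>Symmetry swaps the last two factors; with \<open>\<one>\<close> as the first factor this is reversibility.\<close>

lemma symmetric_imp_reversible:
  assumes "ring R" "symmetric_ring R"
  shows "reversible_ring R"
proof -
  interpret ring R by fact
  show ?thesis
    unfolding reversible_ring_def
  proof (intro ballI impI)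
    fix a b assume "a \<in> carrier R" "b \<in> carrier R" "a \<otimes>\<^bsub>R\<^esub> b = \<zero>\<^bsub>R\<^esub>"
    moreover from this have "\<one>\<^bsub>R\<^esub> \<otimes>\<^bsub>R\<^esub> a \<otimes>\<^bsub>R\<^esub> b = \<zero>\<^bsub>R\<^esub>" by simp
    ultimately have "\<one>\<^bsub>R\<^esub> \<otimes>\<^bsub>R\<^esub> b \<otimes>\<^bsub>R\<^esub> a = \<zero>\<^bsub>R\<^esub>"
      using assms(2) unfolding symmetric_ring_def by blast
    then show "b \<otimes>\<^bsub>R\<^esub> a = \<zero>\<^bsub>R\<^esub>"
      using \<open>b \<in> carrier R\<close> by simp
  qed
qed

text \<open>
  The twist is introduced before reversing: from \<open>x b = 0\<close> compatibility gives \<open>x (\<alpha> b) = 0\<close>,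
  and reversibility then moves \<open>\<alpha> b\<close> to the front. Both left-sided conditions rest on this.
\<close>

lemma reversible_imp_left_endo_reversible:
  assumes "\<alpha> \<in> ring_endo R" "compatible_ring R \<alpha>" "reversible_ring R"
  shows "left_endo_reversible_ring R \<alpha>"
  using assms(3) ring_endo_closed[OF assms(1)] compatible_ringD[OF assms(2)]
  by (simp add: left_endo_reversible_ring_def reversible_ring_def)

text \<open>
  Symmetry turns \<open>a b c = 0\<close> into \<open>(a c) b = 0\<close>, which is the left-reversible situation with
  \<open>a c\<close> as a single factor.
\<close>

lemma symmetric_imp_left_endo_symmetric:
  assumes "ring R" "\<alpha> \<in> ring_endo R" "compatible_ring R \<alpha>" "symmetric_ring R"
  shows "left_endo_symmetric_ring R \<alpha>"
proof -
  interpret ring R by fact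
  have left_rev: "left_endo_reversible_ring R \<alpha>"
    using assms reversible_imp_left_endo_reversible symmetric_imp_reversible by blast
  show ?thesis
    unfolding left_endo_symmetric_ring_def
  proof (intro ballI impI)
    fix a b c
    assume carr: "a \<in> carrier R" "b \<in> carrier R" "c \<in> carrier R"
      and "a \<otimes>\<^bsub>R\<^esub> b \<otimes>\<^bsub>R\<^esub> c = \<zero>\<^bsub>R\<^esub>"
    then have "(a \<otimes>\<^bsub>R\<^esub> c) \<otimes>\<^bsub>R\<^esub> b = \<zero>\<^bsub>R\<^esub>"
      using assms(4) unfolding symmetric_ring_def by blast
    then have "\<alpha> b \<otimes>\<^bsub>R\<^esub> (a \<otimes>\<^bsub>R\<^esub> c) = \<zero>\<^bsub>R\<^esub>"
      using left_rev carr unfolding left_endo_reversible_ring_def by blast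
    then show "\<alpha> b \<otimes>\<^bsub>R\<^esub> a \<otimes>\<^bsub>R\<^esub> c = \<zero>\<^bsub>R\<^esub>"
      using carr ring_endo_closed[OF assms(2)] by (simp add: m_assoc)
  qed
qed

theorem theorem2:
  fixes R :: "('a, 'm) ring_scheme" and \<alpha> :: "'a \<Rightarrow> 'a"
  assumes "ring R" and "\<alpha> \<in> ring_endo R" and "compatible_ring R \<alpha>"
  shows "(symmetric_ring R \<longleftrightarrow> endo_symmetric_ring R \<alpha>) \<and>
         (reversible_ring R \<longleftrightarrow> endo_reversible_ring R \<alpha>) \<and>
         (semicommutative_ring R \<longleftrightarrow> endo_semicommutative_ring R \<alpha>)"
  unfolding endo_symmetric_ring_def endo_reversible_ring_def
  using right_endo_symmetric_iff[OF assms(1,3)] symmetric_imp_left_endo_symmetric[OF assms]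
    right_endo_reversible_iff[OF assms(3)] reversible_imp_left_endo_reversible[OF assms(2,3)]
    endo_semicommutative_iff[OF assms(1,3)]
  by blast

end
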